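(* Let $n$ be a positive integer, $0<\beta_1,\beta_2<1$, and let $\underline{X}=(X_1,X_2)$ be a random vector following the $\mathcal{R}(p,q)$-trinomial probability distribution of the second kind with parameters $n$, $\underline{\beta}=(\beta_1,\beta_2)$, $p$ and $q$, i.e. with probability function $$P(X_1=x_1,X_2=x_2)=\begin{bmatrix} n\\ x_1,x_2\end{bmatrix}_{\mathcal{R}(p,q)}\beta_1^{x_1}\beta_2^{x_2}\,(1\ominus\beta_1)^{n-x_1}_{\mathcal{R}(p,q)}\,(1\ominus\beta_2)^{n-x_1-x_2}_{\mathcal{R}(p,q)}$$ for $x_1,x_2\in\{0,1,\dots,n\}$ with $x_1+x_2\le n$. Then its $\mathcal{R}(p,q)$-factorial moments are given as follows. (1) For $m_1\in\{0,1,\dots,n\}$, $$E\big([X_1]_{m_1,\mathcal{R}(p,q)}\big)=\beta_1^{m_1}\,[n]_{m_1,\mathcal{R}(p,q)}.$$ (2) For $x_1\in\{0,1,\dots,n\}$ and $m_2\in\{0,1,\dots,n-x_1\}$, $$E\big([X_2]_{m_2,\mathcal{R}(p,q)}\mid X_1=x_1\big)=\beta_2^{m_2}\,[n-x_1]_{m_2,\mathcal{R}(p,q)}.$$ (3) For $m_2\in\{0,1,\dots,n\}$, $$E\left(\frac{[X_2]_{m_2,\mathcal{R}(p,q)}}{\big(\phi_1^{n-m_2-X_1}\ominus\beta_1\,\phi_2^{n-m_2-X_1}\big)^{m_2}_{\mathcal{R}(p,q)}}\right)=\beta_2^{m_2}\,[n]_{m_2,\mathcal{R}(p,q)}.$$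 (4) For $m_2\in\{0,1,\dots,n\}$ and $m_1\in\{0,1,\dots,n-m_2\}$, $$E\left(\frac{[X_1]_{m_1,\mathcal{R}(p,q)}\,[X_2]_{m_2,\mathcal{R}(p,q)}}{\big(\phi_1^{n-m_2-X_1}\ominus\beta_1\,\phi_2^{n-m_2-X_1}\big)^{m_2}_{\mathcal{R}(p,q)}}\right)=\beta_1^{m_1}\beta_2^{m_2}\,[n]_{m_1+m_2,\mathcal{R}(p,q)}.$$
   Context: Let $0<q<p<1$ be real numbers and let $\mathcal{R}(u,v)=\sum_{s,t=-l}^{\infty}r_{st}u^sv^t$ ($r_{st}\in\mathbb{C}$, $l\in\mathbb{N}\cup\{0\}$) be a meromorphic function on $\mathbb{C}\times\mathbb{C}$ with $\mathcal{R}(p^n,q^n)>0$ for all $n\in\mathbb{N}$ and $\mathcal{R}(1,1)=0$. The $\mathcal{R}(p,q)$-deformed numbers are $[n]_{\mathcal{R}(p,q)}=\mathcal{R}(p^n,q^n)$, and it is assumed that they can be written as $[n]_{\mathcal{R}(p,q)}=\frac{\phi_1^n-\phi_2^n}{\phi_1-\phi_2}$, where $\phi_1\ne\phi_2$ are functions of the deformation parameters $p,q$. Factorials: $[0]!_{\mathcal{R}(p,q)}=1$ and $[n]!_{\mathcal{R}(p,q)}=\prod_{i=1}^{n}[i]_{\mathcal{R}(p,q)}$. Factorial of order $r$: $[u]_{r,\mathcal{R}(p,q)}=\prod_{i=1}^{r}[u-i+1]_{\mathcal{R}(p,q)}$, equal to $1$ for $r=0$. Trinomial coefficient: $\begin{bmatrix}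 n\\ x_1,x_2\end{bmatrix}_{\mathcal{R}(p,q)}=\frac{[n]!_{\mathcal{R}(p,q)}}{[x_1]!_{\mathcal{R}(p,q)}[x_2]!_{\mathcal{R}(p,q)}[n-x_1-x_2]!_{\mathcal{R}(p,q)}}$. Shifted factorial: $(u\ominus v)^n_{\mathcal{R}(p,q)}=\prod_{i=1}^{n}(u\phi_1^{i-1}-v\phi_2^{i-1})$, with $(u\ominus v)^0_{\mathcal{R}(p,q)}=1$. $E$ denotes expectation.
   Formalization: Part (2) is stated when P(X1=x1) is nonzero; parts (3) and (4) when the denominator is nonzero for X1=x1 with m1 ≤ x1 ≤ n-m2 (m1=0 in (3)). Otherwise the expressions are undefined or the formula can fail, e.g. φ1=1, φ2=1/q, β1=q, n=2, m2=1. *)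

theory Defs
  imports "HOL-Probability.Probability"
begin

text \<open>The library treats holomorphic functions of one variable only. In two variables,
  a function is holomorphic when it is Frechet differentiable with complex-linear derivative.\<close>

definition holomorphic2_on :: "(complex \<times> complex \<Rightarrow> complex) \<Rightarrow> (complex \<times> complex) set \<Rightarrow> bool" where
  "holomorphic2_on f S \<longleftrightarrow>
     (\<forall>z\<in>S. \<exists>D. (f has_derivative D) (at z within S) \<and>
                (\<forall>c w. D (c * fst w, c * snd w) = c * D w))"

text \<open>Meromorphic means locally a quotient of holomorphic functions whose denominator does not
  vanish identically. As with the one-variable \<open>meromorphic_on\<close>, values at singular
  points are unconstrained.\<close>

definition meromorphic2_on :: "(complex \<times> complex \<Rightarrow> complex) \<Rightarrow> (complex \<times> complex) set \<Rightarrow> bool" where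
  "meromorphic2_on f S \<longleftrightarrow>
     (\<forall>z\<in>S. \<exists>U g h. open U \<and> connected U \<and> z \<in> U \<and>
        holomorphic2_on g U \<and> holomorphic2_on h U \<and> (\<exists>w\<in>U. h w \<noteq> 0) \<and>
        (\<forall>w\<in>U. h w \<noteq> 0 \<longrightarrow> f w = g w / h w))"

text \<open>The expansion \<open>R(u,v) = \<Sum> r s t u\<^sup>s v\<^sup>t\<close> over \<open>s, t \<ge> -l\<close>, required on some punctured bidisc
  around the origin only, so that further poles of \<open>R\<close> away from the axes are allowed.\<close>

definition has_laurent_expansion2 ::
    "(complex \<times> complex \<Rightarrow> complex) \<Rightarrow> (int \<Rightarrow> int \<Rightarrow> complex) \<Rightarrow> nat \<Rightarrow> bool" where
  "has_laurent_expansion2 R r l \<longleftrightarrow>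
     (\<exists>\<rho>>0. \<forall>u v. 0 < norm u \<and> norm u < \<rho> \<and> 0 < norm v \<and> norm v < \<rho> \<longrightarrow>
        ((\<lambda>(s, t). r s t * u powi s * v powi t) has_sum R (u, v)) ({- int l..} \<times> {- int l..}))"

text \<open>\<open>R\<close> is complex-valued, but its values at \<open>(p\<^sup>k, q\<^sup>k)\<close>, \<open>k \<ge> 0\<close>, will be assumed real, so
  taking the real part loses nothing. The argument is an integer because \<open>u - i + 1\<close> in the
  factorial of order \<open>r\<close> may be negative; this happens only in products that
  also contain the factor \<open>[0] = 0\<close>.\<close>

definition rnum :: "(complex \<times> complex \<Rightarrow> complex) \<Rightarrow> real \<Rightarrow> real \<Rightarrow> int \<Rightarrow> real" where
  "rnum R p q k = Re (R (of_real (p powi k), of_real (q powi k)))"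

definition rfact :: "(complex \<times> complex \<Rightarrow> complex) \<Rightarrow> real \<Rightarrow> real \<Rightarrow> nat \<Rightarrow> real" where
  "rfact R p q n = (\<Prod>i=1..n. rnum R p q (int i))"

definition rfact_order :: "(complex \<times> complex \<Rightarrow> complex) \<Rightarrow> real \<Rightarrow> real \<Rightarrow> nat \<Rightarrow> nat \<Rightarrow> real" where
  "rfact_order R p q u r = (\<Prod>i=1..r. rnum R p q (int u - int i + 1))"

definition rtrinomial :: "(complex \<times> complex \<Rightarrow> complex) \<Rightarrow> real \<Rightarrow> real \<Rightarrow> nat \<Rightarrow> nat \<Rightarrow> nat \<Rightarrow> real" where
  "rtrinomial R p q n x1 x2 =
     rfact R p q n / (rfact R p q x1 * rfact R p q x2 * rfact R p q (n - x1 - x2))"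

text \<open>\<open>rshift a b u v n\<close> is \<open>(u \<ominus> v)\<^sup>n\<close> with \<open>a\<close>, \<open>b\<close> the values of \<open>\<phi>\<^sub>1\<close>, \<open>\<phi>\<^sub>2\<close>.\<close>

definition rshift :: "real \<Rightarrow> real \<Rightarrow> real \<Rightarrow> real \<Rightarrow> nat \<Rightarrow> real" where
  "rshift a b u v n = (\<Prod>i=1..n. u * a ^ (i - 1) - v * b ^ (i - 1))"

definition rtrinomial2_distributed ::
    "'a measure \<Rightarrow> ('a \<Rightarrow> nat \<times> nat) \<Rightarrow> (complex \<times> complex \<Rightarrow> complex) \<Rightarrow> real \<Rightarrow> real \<Rightarrow>
     real \<Rightarrow> real \<Rightarrow> nat \<Rightarrow> real \<Rightarrow> real \<Rightarrow> bool" where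
  "rtrinomial2_distributed M X R p q a b n \<beta>1 \<beta>2 \<longleftrightarrow>
     prob_space M \<and> X \<in> measurable M (count_space UNIV) \<and>
     (\<forall>x1 x2. measure M {\<omega> \<in> space M. X \<omega> = (x1, x2)} =
        (if x1 + x2 \<le> n
         then rtrinomial R p q n x1 x2 * \<beta>1 ^ x1 * \<beta>2 ^ x2
              * rshift a b 1 \<beta>1 (n - x1) * rshift a b 1 \<beta>2 (n - x1 - x2)
         else 0))"

text \<open>The expectation of \<open>Y\<close> conditional on an event \<open>A\<close> of positive probability.\<close>

definition cond_expectation :: "'a measure \<Rightarrow> ('a \<Rightarrow> real) \<Rightarrow> 'a set \<Rightarrow> real" where
  "cond_expectation M Y A = integral\<^sup>L (uniform_measure M A) Y"

text \<open>The denominator \<open>(\<phi>\<^sub>1\<^bsup>n-m-x\<^esup> \<ominus> \<beta> \<phi>\<^sub>2\<^bsup>n-m-x\<^esup>)\<^sup>m\<close>. For \<open>x > n - m\<close> the exponents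
  are negative; then \<open>x2 < m\<close> whenever \<open>x + x2 \<le> n\<close>, and \<open>[x2]\<^sub>m\<close> vanishes.\<close>

definition rdenom :: "real \<Rightarrow> real \<Rightarrow> nat \<Rightarrow> real \<Rightarrow> nat \<Rightarrow> nat \<Rightarrow> real" where
  "rdenom a b n \<beta> m x =
     rshift a b (a powi (int n - int m - int x)) (\<beta> * b powi (int n - int m - int x)) m"

end

theory Submission
  imports Defs
begin

text \<open>
  Put \<open>a = \<phi>\<^sub>1\<close>, \<open>b = \<phi>\<^sub>2\<close>, \<open>[k] = (a\<^sup>k - b\<^sup>k) / (a - b)\<close>. The trinomial probability function is a
  product of two binomial ones: \<open>X\<^sub>1\<close> has weights \<open>[n, k] \<beta>\<^sub>1\<^sup>k (1 \<ominus> \<beta>\<^sub>1)\<^bsup>n-k\<^esup>\<close>, and \<open>X\<^sub>2\<close> given \<open>X\<^sub>1 = x\<close>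
  has the same weights for \<open>n - x\<close> and \<open>\<beta>\<^sub>2\<close>. For such weights the factorial moments follow from
  the absorption rule \<open>[k]\<^sub>r [m, k] = [m]\<^sub>r [m - r, k - r]\<close>, provided that the weights for
  \<open>m - r\<close> have sum 1. The mixed moment comes from summing first over \<open>x\<^sub>2\<close> and then over \<open>x\<^sub>1\<close>;
  the denominator in its statement is the quotient of \<open>(1 \<ominus> \<beta>\<^sub>1)\<^bsup>n-x\<^esup>\<close> by
  \<open>(1 \<ominus> \<beta>\<^sub>1)\<^bsup>n-m-x\<^esup>\<close>, so that dividing by it, together with the rule
  \<open>[n, x] [n - x]\<^sub>m = [n]\<^sub>m [n - m, x]\<close>, turns the weights for \<open>n\<close> into those for \<open>n - m\<close>. The moments of \<open>X\<^sub>1\<close> alone and of \<open>X\<^sub>2\<close> alone are the cases \<open>m\<^sub>2 = 0\<close> and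
  \<open>m\<^sub>1 = 0\<close>.

  The binomial weights do not have sum 1 in general: for \<open>m = 2\<close> the sum is \<open>a + \<beta>\<^sup>2 (1 - a)\<close>.
  What holds for all \<open>a\<close> and \<open>b\<close> is the q-binomial theorem in the form
  \<open>\<Sum>\<^sub>k a\<^bsup>C(k,2)\<^esup> [m, k] \<beta>\<^sup>k (1 \<ominus> \<beta>)\<^bsup>m-k\<^esup> = a\<^bsup>C(m,2)\<^esup>\<close> (\<open>weighted_binomial_sum\<close>).
  Here the assumption that the trinomial weights form a probability
  distribution comes in: it forces \<open>a = 1\<close> when \<open>n \<ge> 2\<close> (\<open>normalisation_forces_a_eq_1\<close>). Applying
  the weighted identity twice gives \<open>E (a\<^bsup>-e(X)\<^esup>) = 1\<close> with an exponent
  \<open>e(x) \<ge> 0\<close> that is positive as soon as \<open>x\<^sub>1 < n\<close>. Non-negativity of the weights and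
  \<open>[2] > 0\<close> give \<open>a > 0\<close>, so for \<open>a \<noteq> 1\<close> all values of \<open>a\<^bsup>-e(X)\<^esup>\<close> lie on one side of \<open>1\<close>; hence \<open>e(X) = 0\<close>
  almost surely, that is \<open>X\<^sub>1 = n\<close> almost surely, while \<open>P(X\<^sub>1 = n) = \<beta>\<^sub>1\<^sup>n < 1\<close>. For \<open>n = 1\<close> the
  exponents \<open>C(k,2)\<close> all vanish, and the weights have sum 1 whatever \<open>a\<close> is.
\<close>

section \<open>Expectations of finitely supported random variables\<close>

lemma (in prob_space) expectation_finite_support:
  fixes X :: "'a \<Rightarrow> 'b::countable" and g :: "'b \<Rightarrow> real"
  assumes X: "X \<in> measurable M (count_space UNIV)"
    and S: "finite S"
    and null: "\<And>x. x \<notin> S \<Longrightarrow> prob {\<omega> \<in> space M. X \<omega> = x} = 0"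
  shows "expectation (\<lambda>\<omega>. g (X \<omega>)) = (\<Sum>x\<in>S. g x * prob {\<omega> \<in> space M. X \<omega> = x})"
proof -
  have sets: "{\<omega> \<in> space M. X \<omega> = x} \<in> sets M" for x
    using measurable_sets[OF X, of "{x}"] by (simp add: vimage_def Int_def conj_commute)
  have "AE \<omega> in M. x \<notin> S \<longrightarrow> X \<omega> \<noteq> x" for x
  proof (cases "x \<in> S")
    case False
    have "AE \<omega> in M. \<omega> \<notin> {\<omega> \<in> space M. X \<omega> = x}"
      using prob_eq_0[OF sets] null[OF False] by blast
    then show ?thesis by (auto elim: AE_mp)
  qed simp
  then have "AE \<omega> in M. \<forall>x. x \<notin> S \<longrightarrow> X \<omega> \<noteq> x"
    by (simp add: AE_all_countable)
  then have AE_S: "AE \<omega> in M. X \<omega> \<in> S"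
    by eventually_elim blast
  have "expectation (\<lambda>\<omega>. g (X \<omega>)) =
      expectation (\<lambda>\<omega>. \<Sum>x\<in>S. g x * indicator {\<omega> \<in> space M. X \<omega> = x} \<omega>)"
  proof (rule integral_cong_AE)
    show "(\<lambda>\<omega>. g (X \<omega>)) \<in> borel_measurable M"
      using X by (rule measurable_compose) simp
    show "(\<lambda>\<omega>. \<Sum>x\<in>S. g x * indicator {\<omega> \<in> space M. X \<omega> = x} \<omega>) \<in> borel_measurable M"
      using sets by simp
    show "AE \<omega> in M. g (X \<omega>) = (\<Sum>x\<in>S. g x * indicator {\<omega> \<in> space M. X \<omega> = x} \<omega>)"
      using AE_S AE_space
    proof eventually_elim
      case (elim \<omega>)
      have "(\<Sum>x\<in>S. g x * indicator {\<omega> \<in> space M. X \<omega> = x} \<omega>)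
          = (\<Sum>x\<in>S. if x = X \<omega> then g x else 0)"
        using elim by (intro sum.cong) (auto simp: indicator_def)
      then show ?case using elim S by (simp add: sum.delta)
    qed
  qed
  also have "\<dots> = (\<Sum>x\<in>S. g x * prob {\<omega> \<in> space M. X \<omega> = x})"
    using sets by (subst Bochner_Integration.integral_sum) (auto simp: emeasure_eq_measure)
  finally show ?thesis .
qed

lemma (in prob_space) cond_expectation_event:
  assumes A: "A \<in> events" and pos: "prob A \<noteq> 0"
    and Y: "Y \<in> borel_measurable M"
  shows "cond_expectation M Y A = expectation (\<lambda>\<omega>. indicator A \<omega> * Y \<omega>) / prob A"
proof -
  have "uniform_measure M A = density M (\<lambda>\<omega>. ennreal (indicator A \<omega> / prob A))"
    unfolding uniform_measure_def
  proof (rule density_cong)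
    show "AE \<omega> in M. indicator A \<omega> / emeasure M A = ennreal (indicator A \<omega> / prob A)"
      using pos by (auto simp: emeasure_eq_measure indicator_def divide_ennreal measure_nonneg
          less_le ennreal_1[symmetric] simp del: ennreal_1 split: if_splits)
  qed (use A in auto)
  then have "cond_expectation M Y A = expectation (\<lambda>\<omega>. (indicator A \<omega> / prob A) *\<^sub>R Y \<omega>)"
    unfolding cond_expectation_def using A Y
    by (simp add: integral_density measure_nonneg)
  also have "\<dots> = expectation (\<lambda>\<omega>. (indicator A \<omega> * Y \<omega>) / prob A)"
    by (intro Bochner_Integration.integral_cong) auto
  finally show ?thesis by simp
qed

section \<open>Deformed binomial coefficients\<close>

locale deformed_numbers =
  fixes R :: "complex \<times> complex \<Rightarrow> complex" and p q a b :: real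
  assumes a_neq_b: "a \<noteq> b"
    and rnum_eq: "\<And>k::nat. rnum R p q (int k) = (a ^ k - b ^ k) / (a - b)"
    and rnum_pos: "\<And>k::nat. k \<ge> 1 \<Longrightarrow> rnum R p q (int k) > 0"
begin

abbreviation num :: "nat \<Rightarrow> real" where
  "num k \<equiv> rnum R p q (int k)"

abbreviation "fct \<equiv> rfact R p q"
abbreviation "falling \<equiv> rfact_order R p q"
abbreviation "shifted \<equiv> rshift a b 1"

definition binom :: "nat \<Rightarrow> nat \<Rightarrow> real" where
  "binom m k = fct m / (fct k * fct (m - k))"

definition binomial_weight :: "real \<Rightarrow> nat \<Rightarrow> nat \<Rightarrow> real" where
  "binomial_weight \<beta> m k = binom m k * \<beta> ^ k * shifted \<beta> (m - k)"

lemma num_0 [simp]: "rnum R p q 0 = 0"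
  using rnum_eq[of 0] by simp

lemma fct_0 [simp]: "fct 0 = 1"
  by (simp add: rfact_def)

lemma fct_Suc: "fct (Suc m) = num (Suc m) * fct m"
  by (simp add: rfact_def)

lemma fct_pos: "fct m > 0"
  unfolding rfact_def by (intro prod_pos) (use rnum_pos in auto)

lemma fct_nonzero [simp]: "fct m \<noteq> 0"
  using fct_pos[of m] by simp

lemma binom_pos: "binom m k > 0"
  by (simp add: binom_def fct_pos)

lemma binom_0 [simp]: "binom m 0 = 1"
  by (simp add: binom_def)

lemma binom_self [simp]: "binom m m = 1"
  by (simp add: binom_def)

lemma num_add: "num (i + j) = a ^ i * num j + b ^ j * num i"
  unfolding rnum_eq using a_neq_b
  by (simp add: divide_simps power_add) (simp add: algebra_simps)

text \<open>Pascal's rule. It comes from \<open>[i + j] = a\<^sup>i [j] + b\<^sup>j [i]\<close>; exchanging \<open>a\<close> and \<open>b\<close> gives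
  a second such rule, but this is the one whose powers cancel against the new factor
  \<open>a\<^bsup>m-k\<^esup> - \<beta> b\<^bsup>m-k\<^esup>\<close> of the shifted factorial.\<close>

lemma binom_Suc_Suc:
  assumes "k < m"
  shows "binom (Suc m) (Suc k) = a ^ Suc k * binom m (Suc k) + b ^ (m - k) * binom m k"
proof -
  obtain d where d: "m = Suc (k + d)"
    using assms less_iff_Suc_add by blast
  have split: "num (Suc m) = a ^ Suc k * num (Suc d) + b ^ Suc d * num (Suc k)"
    using num_add[of "Suc k" "Suc d"] d by simp
  have nz: "num (Suc k) \<noteq> 0" "num (Suc d) \<noteq> 0"
    using rnum_pos[of "Suc k"] rnum_pos[of "Suc d"] by linarith+
  have m: "Suc m - Suc k = Suc d" "m - Suc k = d" "m - k = Suc d"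
    using d by auto
  show ?thesis
    unfolding binom_def m fct_Suc[of m] fct_Suc[of k] fct_Suc[of d] split
    using nz by (simp add: divide_simps) (simp add: algebra_simps)
qed

lemma shifted_Suc: "shifted \<beta> (Suc m) = shifted \<beta> m * (a ^ m - \<beta> * b ^ m)"
  by (simp add: rshift_def)

lemma shifted_0 [simp]: "shifted \<beta> 0 = 1"
  by (simp add: rshift_def)

text \<open>With \<open>q = b / a\<close> the summand is \<open>a\<^bsup>C(m,2)\<^esup>\<close> times the summand
  \<open>[m, k]\<^sub>q \<beta>\<^sup>k (1 - \<beta>) (1 - \<beta> q) \<cdots> (1 - \<beta> q\<^bsup>m-k-1\<^esup>)\<close> of the q-binomial theorem, and
  \<open>a\<^bsup>C(k,2)\<^esup>\<close> is the factor that makes it homogeneous. In the induction, passing from \<open>m\<close>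
  to \<open>m + 1\<close> multiplies the sum by \<open>a\<^sup>m\<close>, because the other terms telescope.\<close>

lemma weighted_binomial_sum:
  "(\<Sum>k\<le>m. a ^ (k choose 2) * binomial_weight \<beta> m k) = a ^ (m choose 2)"
proof (induction m)
  case 0
  then show ?case by (simp add: binomial_weight_def numeral_2_eq_2)
next
  case (Suc m)
  define c where "c k = a ^ (k choose 2) * binom m k * \<beta> ^ k * shifted \<beta> (m - k)" for k
  define t where "t k = a ^ k * b ^ (m - k) * \<beta> * c k" for k
  have choose_Suc: "Suc k choose 2 = k + (k choose 2)" for k
    by (simp add: numeral_2_eq_2)
  \<comment> \<open>Passing from \<open>m\<close> to \<open>m + 1\<close>: the first summand of Pascal's rule
      turns the term \<open>c k\<close> into \<open>a\<^sup>m c k - t k\<close>, the second one turns \<open>c (k - 1)\<close> into \<open>t (k - 1)\<close>.\<close>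
  have step: "a ^ (Suc k choose 2) * binomial_weight \<beta> (Suc m) (Suc k)
      = (a ^ m * c (Suc k) - t (Suc k)) + t k" if "k < m" for k
  proof -
    define d where "d = m - Suc k"
    have m: "m = Suc k + d"
      using that by (simp add: d_def)
    have am: "a ^ m = a ^ Suc k * a ^ d"
      by (subst m) (rule power_add)
    have diff: "Suc m - Suc k = Suc d" "m - k = Suc d" "m - Suc k = d"
      using m by linarith+
    show ?thesis
      unfolding binomial_weight_def binom_Suc_Suc[OF that] t_def c_def am diff shifted_Suc choose_Suc
      by (simp add: power_add algebra_simps)
  qed
  have zero: "a ^ (0 choose 2) * binomial_weight \<beta> (Suc m) 0 = a ^ m * c 0 - t 0"
    unfolding binomial_weight_def t_def c_def
    by (simp add: shifted_Suc algebra_simps numeral_2_eq_2)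
  have last: "a ^ (Suc m choose 2) * binomial_weight \<beta> (Suc m) (Suc m) = t m"
    unfolding binomial_weight_def t_def c_def choose_Suc by (simp add: power_add)
  have "(\<Sum>k\<le>Suc m. a ^ (k choose 2) * binomial_weight \<beta> (Suc m) k)
      = (\<Sum>k<Suc m. a ^ (k choose 2) * binomial_weight \<beta> (Suc m) k) + t m"
    by (simp add: last lessThan_Suc_atMost)
  also have "\<dots> = (a ^ m * c 0 - t 0) + (\<Sum>k<m. (a ^ m * c (Suc k) - t (Suc k)) + t k) + t m"
    by (simp only: sum.lessThan_Suc_shift zero) (simp add: step cong: sum.cong_simp)
  also have "\<dots> = (\<Sum>k<Suc m. a ^ m * c k - t k) + (\<Sum>k<Suc m. t k)"
    by (simp only: sum.lessThan_Suc_shift[of "\<lambda>k. a ^ m * c k - t k"]) (simp add: sum.distrib)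
  also have "\<dots> = a ^ m * (\<Sum>k\<le>m. c k)"
    by (simp add: sum_subtractf sum_distrib_left lessThan_Suc_atMost del: sum.lessThan_Suc)
  also have "(\<Sum>k\<le>m. c k) = a ^ (m choose 2)"
    unfolding c_def Suc.IH[symmetric] binomial_weight_def by (simp add: mult.assoc)
  finally show ?case by (simp add: choose_Suc power_add)
qed

lemma binomial_weight_sum:
  assumes "a = 1 \<or> m \<le> 1"
  shows "(\<Sum>k\<le>m. binomial_weight \<beta> m k) = 1"
proof -
  have "a ^ (k choose 2) = 1" if "k \<le> m" for k
    using assms that by (auto simp: binomial_eq_0)
  then show ?thesis
    using weighted_binomial_sum[of \<beta> m] by (simp cong: sum.cong_simp)
qed

section \<open>Factorial moments of the deformed binomial weights\<close>

text \<open>The product runs through the factor \<open>[0] = 0\<close>; its later factors \<open>[-1], [-2], \<dots>\<close> are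
  unconstrained.\<close>

lemma falling_eq_0:
  assumes "u < r"
  shows "falling u r = 0"
  unfolding rfact_order_def
proof (rule prod_zero)
  show "\<exists>i\<in>{1..r}. rnum R p q (int u - int i + 1) = 0"
    using assms by (intro bexI[of _ "Suc u"]) auto
qed simp

lemma falling_0 [simp]: "falling u 0 = 1"
  by (simp add: rfact_order_def)

lemma falling_eq_quotient:
  assumes "r \<le> u"
  shows "falling u r = fct u / fct (u - r)"
  using assms
proof (induction r)
  case (Suc r)
  then obtain d where d: "u = Suc (r + d)"
    using less_iff_Suc_add Suc_le_eq by metis
  have "falling u (Suc r) = falling u r * num (Suc d)"
    by (simp add: rfact_order_def d)
  moreover have "num (Suc d) \<noteq> 0"
    using rnum_pos[of "Suc d"] by linarith
  moreover have "u - r = Suc d" "u - Suc r = d"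
    by (auto simp: d)
  ultimately show ?case
    using Suc fct_Suc[of d] by (simp add: divide_simps)
qed simp

lemma falling_add:
  assumes "r + s \<le> u"
  shows "falling u (r + s) = falling u r * falling (u - r) s"
  using assms by (simp add: falling_eq_quotient)

lemma falling_times_binom:
  assumes "r \<le> k" "k \<le> m"
  shows "falling k r * binom m k = falling m r * binom (m - r) (k - r)"
  using assms by (simp add: falling_eq_quotient binom_def)

lemma binom_times_falling:
  assumes "k + r \<le> m"
  shows "binom m k * falling (m - k) r = falling m r * binom (m - r) k"
proof -
  have "m - k - r = m - r - k" by simp
  then show ?thesis
    using assms by (simp add: falling_eq_quotient binom_def)
qed

text \<open>Absorption leaves the sum of the weights for \<open>m - r\<close> with the same \<open>\<beta>\<close>: the shift
  \<open>k \<mapsto> k - r\<close> leaves \<open>(1 \<ominus> \<beta>)\<^bsup>m-k\<^esup>\<close> unchanged and frees \<open>\<beta>\<^sup>r\<close>.\<close>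

lemma binomial_factorial_moment:
  assumes r: "r \<le> m" and "a = 1 \<or> m \<le> 1"
  shows "(\<Sum>k\<le>m. falling k r * binomial_weight \<beta> m k) = \<beta> ^ r * falling m r"
proof -
  have shift: "falling (j + r) r * binomial_weight \<beta> m (j + r)
      = \<beta> ^ r * falling m r * binomial_weight \<beta> (m - r) j" if "j \<le> m - r" for j
  proof -
    have "m - (j + r) = m - r - j" by simp
    moreover have "falling (j + r) r * binom m (j + r) = falling m r * binom (m - r) j"
      using falling_times_binom[of r "j + r" m] that r by simp
    ultimately show ?thesis
      unfolding binomial_weight_def by (simp add: power_add mult_ac)
  qed
  have "(\<Sum>k\<le>m. falling k r * binomial_weight \<beta> m k)
      = (\<Sum>k\<in>{r..m}. falling k r * binomial_weight \<beta> m k)"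
    by (rule sum.mono_neutral_right) (auto simp: falling_eq_0)
  also have "\<dots> = (\<Sum>j\<le>m - r. falling (j + r) r * binomial_weight \<beta> m (j + r))"
    by (rule sum.reindex_bij_witness[of _ "\<lambda>j. j + r" "\<lambda>k. k - r"]) (use r in auto)
  also have "\<dots> = \<beta> ^ r * falling m r * (\<Sum>j\<le>m - r. binomial_weight \<beta> (m - r) j)"
    unfolding sum_distrib_left by (intro sum.cong) (auto simp: shift)
  also have "(\<Sum>j\<le>m - r. binomial_weight \<beta> (m - r) j) = 1"
    by (rule binomial_weight_sum) (use assms in auto)
  finally show ?thesis by simp
qed

section \<open>The trinomial weights\<close>

lemma rshift_add:
  "rshift a b u v (i + j) = rshift a b u v i * rshift a b (u * a ^ i) (v * b ^ i) j"
  by (induction j) (simp_all add: rshift_def power_add algebra_simps)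

text \<open>The last \<open>m\<close> factors of \<open>(1 \<ominus> \<beta>)\<^bsup>n-x\<^esup>\<close> form the denominator in the moments of \<open>X\<^sub>2\<close>.\<close>

lemma shifted_eq_times_rdenom:
  assumes "x + m \<le> n"
  shows "shifted \<beta> (n - x) = shifted \<beta> (n - m - x) * rdenom a b n \<beta> m x"
proof -
  define d where "d = n - m - x"
  have "int n - int m - int x = int d" "n - x = d + m"
    using assms by (auto simp: d_def)
  then show ?thesis
    unfolding rdenom_def d_def[symmetric] by (simp add: rshift_add power_int_of_nat)
qed

definition trinomial_weight :: "nat \<Rightarrow> real \<Rightarrow> real \<Rightarrow> nat \<Rightarrow> nat \<Rightarrow> real" where
  "trinomial_weight n \<beta>1 \<beta>2 x1 x2 =
     rtrinomial R p q n x1 x2 * \<beta>1 ^ x1 * \<beta>2 ^ x2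
       * shifted \<beta>1 (n - x1) * shifted \<beta>2 (n - x1 - x2)"

lemma trinomial_weight_eq:
  "trinomial_weight n \<beta>1 \<beta>2 x1 x2 = binomial_weight \<beta>1 n x1 * binomial_weight \<beta>2 (n - x1) x2"
  by (simp add: trinomial_weight_def binomial_weight_def rtrinomial_def binom_def field_simps)

text \<open>The inner sum over \<open>x2\<close> contributes \<open>[n - x1]\<close> of order \<open>m2\<close>, which turns \<open>[n, x1]\<close> into
  \<open>[n - m2, x1]\<close> up to a constant factor, just as the division by the denominator turns \<open>(1 \<ominus> \<beta>1)\<^bsup>n-x1\<^esup>\<close> into
  \<open>(1 \<ominus> \<beta>1)\<^bsup>n-m2-x1\<^esup>\<close>. What remains is a factorial moment for \<open>n - m2\<close>.\<close>

lemma trinomial_factorial_moment: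
  assumes m: "m1 + m2 \<le> n" and norm: "a = 1 \<or> n \<le> 1"
    and denom: "\<And>x1. x1 \<in> {m1..n - m2} \<Longrightarrow> rdenom a b n \<beta>1 m2 x1 \<noteq> 0"
  shows "(\<Sum>x1\<le>n. \<Sum>x2\<le>n - x1. falling x1 m1 * falling x2 m2 / rdenom a b n \<beta>1 m2 x1
            * trinomial_weight n \<beta>1 \<beta>2 x1 x2)
         = \<beta>1 ^ m1 * \<beta>2 ^ m2 * falling n (m1 + m2)"
proof -
  let ?D = "rdenom a b n \<beta>1 m2"
  let ?inner = "\<lambda>x1. \<Sum>x2\<le>n - x1. falling x2 m2 * binomial_weight \<beta>2 (n - x1) x2"
  have outer: "falling x1 m1 / ?D x1 * binomial_weight \<beta>1 n x1 * ?inner x1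
      = \<beta>2 ^ m2 * falling n m2 * (falling x1 m1 * binomial_weight \<beta>1 (n - m2) x1)"
    if x1: "x1 \<le> n - m2" for x1
  proof (cases "m1 \<le> x1")
    case True
    have le: "x1 + m2 \<le> n" using x1 m by simp
    have inner: "?inner x1 = \<beta>2 ^ m2 * falling (n - x1) m2"
      by (rule binomial_factorial_moment) (use le norm in auto)
    have ratio: "binomial_weight \<beta>1 n x1 / ?D x1 * falling (n - x1) m2
        = falling n m2 * binomial_weight \<beta>1 (n - m2) x1"
      using denom[of x1] True x1 binom_times_falling[OF le]
      unfolding binomial_weight_def shifted_eq_times_rdenom[OF le] by simp
    have "falling x1 m1 / ?D x1 * binomial_weight \<beta>1 n x1 * ?inner x1
        = \<beta>2 ^ m2 * falling x1 m1 * (binomial_weight \<beta>1 n x1 / ?D x1 * falling (n - x1) m2)"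
      unfolding inner by (simp add: mult_ac)
    then show ?thesis
      unfolding ratio by (simp only: mult_ac)
  qed (simp add: falling_eq_0)
  have "(\<Sum>x1\<le>n. \<Sum>x2\<le>n - x1. falling x1 m1 * falling x2 m2 / ?D x1
            * trinomial_weight n \<beta>1 \<beta>2 x1 x2)
      = (\<Sum>x1\<le>n. falling x1 m1 / ?D x1 * binomial_weight \<beta>1 n x1 * ?inner x1)"
    unfolding trinomial_weight_eq sum_distrib_left
    by (intro sum.cong refl) (simp add: mult_ac)
  \<comment> \<open>Beyond \<open>n - m2\<close> the inner sum vanishes, since there \<open>x2 \<le> n - x1 < m2\<close>.\<close>
  also have "\<dots> = (\<Sum>x1\<le>n - m2. falling x1 m1 / ?D x1 * binomial_weight \<beta>1 n x1 * ?inner x1)"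
    by (rule sum.mono_neutral_right) (auto intro!: sum.neutral simp: falling_eq_0)
  also have "\<dots> = \<beta>2 ^ m2 * falling n m2 *
      (\<Sum>x1\<le>n - m2. falling x1 m1 * binomial_weight \<beta>1 (n - m2) x1)"
    unfolding sum_distrib_left[of "\<beta>2 ^ m2 * falling n m2"]
    by (intro sum.cong refl outer) simp
  also have "\<dots> = \<beta>2 ^ m2 * falling n m2 * (\<beta>1 ^ m1 * falling (n - m2) m1)"
    by (subst binomial_factorial_moment) (use m norm in auto)
  also have "\<dots> = \<beta>1 ^ m1 * \<beta>2 ^ m2 * falling n (m1 + m2)"
    using falling_add[of m2 m1 n] m by (simp add: add.commute)
  finally show ?thesis .
qed

text \<open>The powers of \<open>a\<close> in \<open>weighted_binomial_sum\<close> act as a change of measure that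
  preserves the total mass 1. As the density is monotone in \<open>a\<close>, and equal to 1 for \<open>a = 1\<close>, this is
  impossible for \<open>a \<noteq> 1\<close> unless the density is 1 almost everywhere.\<close>

lemma normalisation_forces_a_eq_1:
  assumes n: "n \<ge> 2"
    and \<beta>: "0 < \<beta>1" "\<beta>1 < 1" "0 < \<beta>2"
    and nonneg: "\<And>x1 x2. x1 + x2 \<le> n \<Longrightarrow> trinomial_weight n \<beta>1 \<beta>2 x1 x2 \<ge> 0"
    and total: "(\<Sum>x1\<le>n. \<Sum>x2\<le>n - x1. trinomial_weight n \<beta>1 \<beta>2 x1 x2) = 1"
  shows "a = 1"
proof (rule ccontr)
  assume a1: "a \<noteq> 1"
  define w where "w = trinomial_weight n \<beta>1 \<beta>2"
  \<comment> \<open>Two trials after the first stage suffice: \<open>P(n - 2, 2) \<ge> 0\<close> gives \<open>a \<ge> \<beta>1 b\<close>, and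
      \<open>[2] = a + b\<close> is positive.\<close>
  have a_pos: "a > 0"
  proof -
    have "n - (n - 2) = Suc (Suc 0)" using n by simp
    moreover have "w (n - 2) 2 \<ge> 0"
      unfolding w_def by (rule nonneg) (use n in simp)
    ultimately have "(binom n (n - 2) * \<beta>1 ^ (n - 2) * \<beta>2 ^ 2 * (1 - \<beta>1)) * (a - \<beta>1 * b) \<ge> 0"
      unfolding w_def trinomial_weight_eq binomial_weight_def
      by (simp add: shifted_Suc mult_ac numeral_2_eq_2)
    moreover have "binom n (n - 2) * \<beta>1 ^ (n - 2) * \<beta>2 ^ 2 * (1 - \<beta>1) > 0"
      using \<beta> binom_pos by simp
    ultimately have ge: "a \<ge> \<beta>1 * b"
      by (simp add: zero_le_mult_iff)
    have "num 2 = a + b"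
      using a_neq_b by (simp only: rnum_eq) (simp add: field_simps power2_eq_square)
    then have "a + b > 0"
      using rnum_pos[of 2] by simp
    then show ?thesis
      using ge \<beta>(1) mult_pos_pos[of \<beta>1 b] by (cases "b > 0") linarith+
  qed
  define e where "e x1 x2 = ((n choose 2) - (x1 choose 2)) + (((n - x1) choose 2) - (x2 choose 2))"
    for x1 x2
  have choose_mono: "i choose 2 \<le> j choose 2" if "i \<le> j" for i j :: nat
    unfolding choose_two using that by (intro div_le_mono mult_le_mono) auto
  have row: "(\<Sum>x2\<le>n - x1. w x1 x2 / a ^ e x1 x2)
      = binomial_weight \<beta>1 n x1 / a ^ ((n choose 2) - (x1 choose 2))" for x1
  proof -
    have "(\<Sum>x2\<le>n - x1. w x1 x2 / a ^ e x1 x2)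
        = (\<Sum>x2\<le>n - x1. binomial_weight \<beta>1 n x1 / a ^ ((n choose 2) - (x1 choose 2)) / a ^ ((n - x1) choose 2)
            * (a ^ (x2 choose 2) * binomial_weight \<beta>2 (n - x1) x2))"
    proof (intro sum.cong refl)
      fix x2 assume "x2 \<in> {..n - x1}"
      then have "a ^ ((n - x1) choose 2) = a ^ (((n - x1) choose 2) - (x2 choose 2)) * a ^ (x2 choose 2)"
        using choose_mono[of x2 "n - x1"] by (simp flip: power_add)
      then show "w x1 x2 / a ^ e x1 x2
          = binomial_weight \<beta>1 n x1 / a ^ ((n choose 2) - (x1 choose 2)) / a ^ ((n - x1) choose 2)
            * (a ^ (x2 choose 2) * binomial_weight \<beta>2 (n - x1) x2)"
        using a_pos by (simp add: w_def trinomial_weight_eq e_def power_add)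
    qed
    then show ?thesis
      unfolding sum_distrib_left[symmetric] weighted_binomial_sum using a_pos by simp
  qed
  have "(\<Sum>x1\<le>n. \<Sum>x2\<le>n - x1. w x1 x2 / a ^ e x1 x2)
      = (\<Sum>x1\<le>n. a ^ (x1 choose 2) * binomial_weight \<beta>1 n x1 / a ^ (n choose 2))"
  proof (intro sum.cong refl)
    fix x1 assume "x1 \<in> {..n}"
    then have "a ^ (n choose 2) = a ^ ((n choose 2) - (x1 choose 2)) * a ^ (x1 choose 2)"
      using choose_mono[of x1 n] by (simp flip: power_add)
    then show "(\<Sum>x2\<le>n - x1. w x1 x2 / a ^ e x1 x2)
        = a ^ (x1 choose 2) * binomial_weight \<beta>1 n x1 / a ^ (n choose 2)"
      using a_pos by (simp add: row)
  qed
  also have "\<dots> = 1"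
    using a_pos by (simp add: weighted_binomial_sum flip: sum_divide_distrib)
  finally have tilted: "(\<Sum>x1\<le>n. \<Sum>x2\<le>n - x1. w x1 x2 / a ^ e x1 x2) = 1" .
  define S where "S = (SIGMA x1:{..n}. {..n - x1})"
  define d where "d = (\<lambda>(x1, x2). w x1 x2 * (1 / a ^ e x1 x2 - 1))"
  have fin: "finite S" by (simp add: S_def)
  have "(\<Sum>x\<in>S. d x) = 0"
    using tilted total unfolding S_def d_def w_def[symmetric]
    by (simp add: sum.Sigma[symmetric] right_diff_distrib sum_subtractf)
  \<comment> \<open>All the powers \<open>1 / a\<^sup>e\<close> lie on the same side of \<open>1\<close>.\<close>
  moreover have "(\<forall>x\<in>S. 0 \<le> d x) \<or> (\<forall>x\<in>S. d x \<le> 0)"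
  proof (cases "a < 1")
    case True
    have "1 / a ^ k - 1 \<ge> 0" for k
      using a_pos True power_le_one[of a k] by simp
    then have "\<forall>x\<in>S. 0 \<le> d x"
      unfolding d_def S_def using nonneg by (auto simp: w_def)
    then show ?thesis ..
  next
    case False
    have "1 / a ^ k - 1 \<le> 0" for k
      using a_pos False one_le_power[of a k] by simp
    then have "\<forall>x\<in>S. d x \<le> 0"
      unfolding d_def S_def using nonneg by (auto simp: w_def intro!: mult_nonneg_nonpos)
    then show ?thesis ..
  qed
  ultimately have "\<forall>x\<in>S. d x = 0"
    using sum_nonneg_eq_0_iff[OF fin, of d] sum_nonneg_eq_0_iff[OF fin, of "\<lambda>x. - d x"]
    unfolding sum_negf neg_0_le_iff_le neg_equal_0_iff_equal by metis
  then have d0: "d (x1, x2) = 0" if "x1 < n" "x2 \<le> n - x1" for x1 x2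
    using that unfolding S_def by fastforce
  have w0: "w x1 x2 = 0" if x: "x1 < n" "x2 \<le> n - x1" for x1 x2
  proof -
    \<comment> \<open>The first difference in \<open>e\<close> is positive, since \<open>n choose 2\<close> grows strictly from \<open>n - 1 \<ge> 1\<close> on.\<close>
    have "x1 choose 2 \<le> (n - 1) choose 2"
      using x by (intro choose_mono) simp
    also have "\<dots> < n choose 2"
    proof -
      obtain k where "n = Suc (Suc k)" using n by (metis Suc_le_D numeral_2_eq_2 Suc_le_mono)
      then show ?thesis by (simp add: numeral_2_eq_2)
    qed
    finally have "e x1 x2 > 0" by (simp add: e_def)
    then have "a ^ e x1 x2 \<noteq> 1"
      using a_pos a1 power_eq_1_iff[of a "e x1 x2"] by auto
    then show ?thesis
      using d0[OF x] a_pos by (simp add: d_def)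
  qed
  have "(\<Sum>x1\<le>n. \<Sum>x2\<le>n - x1. w x1 x2) = (\<Sum>x1\<in>{n}. \<Sum>x2\<le>n - x1. w x1 x2)"
    by (rule sum.mono_neutral_right) (auto intro!: sum.neutral w0)
  also have "\<dots> = \<beta>1 ^ n"
    by (simp add: w_def trinomial_weight_eq binomial_weight_def)
  finally have "\<beta>1 ^ n = 1" using total by (simp add: w_def)
  moreover have "\<beta>1 ^ n < 1"
    using \<beta> n by (intro power_less_one_iff[THEN iffD2]) auto
  ultimately show False by simp
qed

end

theorem theorem2p10:
  fixes p q \<beta>1 \<beta>2 :: real
    and R :: "complex \<times> complex \<Rightarrow> complex"
    and r :: "int \<Rightarrow> int \<Rightarrow> complex"
    and l n :: nat
    and \<phi>1 \<phi>2 :: "real \<Rightarrow> real \<Rightarrow> real"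
    and M :: "'a measure"
    and X :: "'a \<Rightarrow> nat \<times> nat"
  assumes "0 < q" and "q < p" and "p < 1"
    and "meromorphic2_on R UNIV"
    and "has_laurent_expansion2 R r l"
    and "\<And>k::nat. k \<ge> 1 \<Longrightarrow> R (of_real (p ^ k), of_real (q ^ k)) \<in> \<real>
                          \<and> Re (R (of_real (p ^ k), of_real (q ^ k))) > 0"
    and "R (1, 1) = 0"
    and "\<phi>1 p q \<noteq> \<phi>2 p q"
    and "\<And>k::nat. rnum R p q (int k) = (\<phi>1 p q ^ k - \<phi>2 p q ^ k) / (\<phi>1 p q - \<phi>2 p q)"
    and "n \<ge> 1"
    and "0 < \<beta>1" and "\<beta>1 < 1" and "0 < \<beta>2" and "\<beta>2 < 1"
    and "rtrinomial2_distributed M X R p q (\<phi>1 p q) (\<phi>2 p q) n \<beta>1 \<beta>2"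
  shows
    "(\<forall>m1\<le>n.
        prob_space.expectation M (\<lambda>\<omega>. rfact_order R p q (fst (X \<omega>)) m1)
        = \<beta>1 ^ m1 * rfact_order R p q n m1)
   \<and> (\<forall>x1\<le>n. \<forall>m2\<le>n - x1.
        measure M {\<omega> \<in> space M. fst (X \<omega>) = x1} \<noteq> 0 \<longrightarrow>
        cond_expectation M (\<lambda>\<omega>. rfact_order R p q (snd (X \<omega>)) m2) {\<omega> \<in> space M. fst (X \<omega>) = x1}
        = \<beta>2 ^ m2 * rfact_order R p q (n - x1) m2)
   \<and> (\<forall>m2\<le>n.
        (\<forall>x1\<le>n - m2. rdenom (\<phi>1 p q) (\<phi>2 p q) n \<beta>1 m2 x1 \<noteq> 0) \<longrightarrow>
        prob_space.expectation M
          (\<lambda>\<omega>. rfact_order R p q (snd (X \<omega>)) m2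
                / rdenom (\<phi>1 p q) (\<phi>2 p q) n \<beta>1 m2 (fst (X \<omega>)))
        = \<beta>2 ^ m2 * rfact_order R p q n m2)
   \<and> (\<forall>m2\<le>n. \<forall>m1\<le>n - m2.
        (\<forall>x1\<in>{m1..n - m2}. rdenom (\<phi>1 p q) (\<phi>2 p q) n \<beta>1 m2 x1 \<noteq> 0) \<longrightarrow>
        prob_space.expectation M
          (\<lambda>\<omega>. rfact_order R p q (fst (X \<omega>)) m1 * rfact_order R p q (snd (X \<omega>)) m2
                / rdenom (\<phi>1 p q) (\<phi>2 p q) n \<beta>1 m2 (fst (X \<omega>)))
        = \<beta>1 ^ m1 * \<beta>2 ^ m2 * rfact_order R p q n (m1 + m2))"
proof -
  let ?a = "\<phi>1 p q" and ?b = "\<phi>2 p q"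
  let ?E = "prob_space.expectation M"
  interpret deformed_numbers R p q ?a ?b
  proof
    fix k :: nat assume "k \<ge> 1"
    then show "rnum R p q (int k) > 0"
      using assms(6)[of k] by (simp add: rnum_def power_int_of_nat)
  qed (use assms(8,9) in auto)
  interpret prob_space M
    using assms(15) by (simp add: rtrinomial2_distributed_def)
  have X: "X \<in> measurable M (count_space UNIV)"
    and law: "prob {\<omega> \<in> space M. X \<omega> = (x1, x2)}
        = (if x1 + x2 \<le> n then trinomial_weight n \<beta>1 \<beta>2 x1 x2 else 0)" for x1 x2
    using assms(15) by (auto simp: rtrinomial2_distributed_def trinomial_weight_def)
  have E_eq: "?E (\<lambda>\<omega>. g (fst (X \<omega>)) (snd (X \<omega>)))
      = (\<Sum>x1\<le>n. \<Sum>x2\<le>n - x1. g x1 x2 * trinomial_weight n \<beta>1 \<beta>2 x1 x2)"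
    for g :: "nat \<Rightarrow> nat \<Rightarrow> real"
  proof -
    let ?S = "SIGMA x1:{..n}. {..n - x1}"
    have "?E (\<lambda>\<omega>. case_prod g (X \<omega>))
        = (\<Sum>x\<in>?S. case_prod g x * prob {\<omega> \<in> space M. X \<omega> = x})"
      by (rule expectation_finite_support[OF X]) (auto simp: law split: if_splits)
    also have "\<dots> = (\<Sum>x1\<le>n. \<Sum>x2\<le>n - x1. g x1 x2 * prob {\<omega> \<in> space M. X \<omega> = (x1, x2)})"
      by (simp add: sum.Sigma case_prod_beta)
    also have "\<dots> = (\<Sum>x1\<le>n. \<Sum>x2\<le>n - x1. g x1 x2 * trinomial_weight n \<beta>1 \<beta>2 x1 x2)"
      by (intro sum.cong refl) (auto simp: law)
    finally show ?thesis by (simp add: case_prod_beta)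
  qed
  have norm: "?a = 1 \<or> n \<le> 1"
  proof (rule disjCI)
    assume "\<not> n \<le> 1"
    moreover have "trinomial_weight n \<beta>1 \<beta>2 x1 x2 \<ge> 0" if "x1 + x2 \<le> n" for x1 x2
      using law[of x1 x2] that measure_nonneg[of M "{\<omega> \<in> space M. X \<omega> = (x1, x2)}"] by simp
    moreover have "(\<Sum>x1\<le>n. \<Sum>x2\<le>n - x1. trinomial_weight n \<beta>1 \<beta>2 x1 x2) = 1"
      using E_eq[of "\<lambda>_ _. 1"] by (simp add: prob_space)
    ultimately show "?a = 1"
      using assms(11-13) by (intro normalisation_forces_a_eq_1) auto
  qed
  have moment: "?E (\<lambda>\<omega>. falling (fst (X \<omega>)) m1 * falling (snd (X \<omega>)) m2
                / rdenom ?a ?b n \<beta>1 m2 (fst (X \<omega>)))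
      = \<beta>1 ^ m1 * \<beta>2 ^ m2 * falling n (m1 + m2)"
    if "m1 + m2 \<le> n" "\<forall>x1\<in>{m1..n - m2}. rdenom ?a ?b n \<beta>1 m2 x1 \<noteq> 0" for m1 m2
    using E_eq[of "\<lambda>x1 x2. falling x1 m1 * falling x2 m2 / rdenom ?a ?b n \<beta>1 m2 x1"]
      trinomial_factorial_moment[OF that(1) norm, of \<beta>1 \<beta>2] that(2) by simp
  have "?E (\<lambda>\<omega>. falling (fst (X \<omega>)) m1) = \<beta>1 ^ m1 * falling n m1" if "m1 \<le> n" for m1
    using moment[of m1 0] that by (simp add: rdenom_def rshift_def)
  moreover have "cond_expectation M (\<lambda>\<omega>. falling (snd (X \<omega>)) m2) {\<omega> \<in> space M. fst (X \<omega>) = x1}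
        = \<beta>2 ^ m2 * falling (n - x1) m2"
    if x1: "x1 \<le> n" and m2: "m2 \<le> n - x1"
      and nz: "prob {\<omega> \<in> space M. fst (X \<omega>) = x1} \<noteq> 0" for x1 m2
  proof -
    let ?A = "{\<omega> \<in> space M. fst (X \<omega>) = x1}"
    have fst_X: "(\<lambda>\<omega>. fst (X \<omega>)) \<in> measurable M (count_space UNIV)"
      using X by (rule measurable_compose) simp
    have A: "?A \<in> events"
      using measurable_sets[OF fst_X, of "{x1}"] by (simp add: vimage_def Int_def conj_commute)
    have snd_X: "(\<lambda>\<omega>. falling (snd (X \<omega>)) m) \<in> borel_measurable M" for m
      using X by (rule measurable_compose) simp
    have slice: "?E (\<lambda>\<omega>. indicator ?A \<omega> * falling (snd (X \<omega>)) m)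
        = binomial_weight \<beta>1 n x1 * (\<beta>2 ^ m * falling (n - x1) m)" if m: "m \<le> n - x1" for m
    proof -
      have "?E (\<lambda>\<omega>. indicator ?A \<omega> * falling (snd (X \<omega>)) m)
          = ?E (\<lambda>\<omega>. (if fst (X \<omega>) = x1 then 1 else 0) * falling (snd (X \<omega>)) m)"
        by (intro Bochner_Integration.integral_cong) auto
      also have "\<dots> = (\<Sum>y\<le>n. if y = x1
          then \<Sum>x2\<le>n - y. falling x2 m * trinomial_weight n \<beta>1 \<beta>2 y x2 else 0)"
        by (subst E_eq[of "\<lambda>y x2. (if y = x1 then 1 else 0) * falling x2 m"])
          (intro sum.cong refl, auto)
      also have "\<dots> = (\<Sum>x2\<le>n - x1. falling x2 m * trinomial_weight n \<beta>1 \<beta>2 x1 x2)"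
        using x1 by (simp add: sum.delta)
      also have "\<dots> = binomial_weight \<beta>1 n x1
          * (\<Sum>x2\<le>n - x1. falling x2 m * binomial_weight \<beta>2 (n - x1) x2)"
        unfolding trinomial_weight_eq sum_distrib_left by (intro sum.cong refl) (simp add: mult_ac)
      also have "(\<Sum>x2\<le>n - x1. falling x2 m * binomial_weight \<beta>2 (n - x1) x2)
          = \<beta>2 ^ m * falling (n - x1) m"
        by (rule binomial_factorial_moment[OF m]) (use norm in auto)
      finally show ?thesis .
    qed
    have "prob ?A = binomial_weight \<beta>1 n x1"
      using slice[of 0] A by simp
    then show ?thesis
      using cond_expectation_event[OF A nz snd_X] slice[OF m2] nz by simp
  qed
  moreover have "?E (\<lambda>\<omega>. falling (snd (X \<omega>)) m2 / rdenom ?a ?b n \<beta>1 m2 (fst (X \<omega>)))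
        = \<beta>2 ^ m2 * falling n m2"
    if "m2 \<le> n" "\<forall>x1\<le>n - m2. rdenom ?a ?b n \<beta>1 m2 x1 \<noteq> 0" for m2
    using moment[of 0 m2] that by simp
  ultimately show ?thesis
    using moment by auto
qed

end
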